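(* Let $1\le p<\infty$. Let $(\Omega,\mathcal A,\mu)$ be the measure space and $\mu=\mu'+\mu''$ the decomposition of $\mu$ constructed in the context, and let $$M:=\{f\in L_p(\mu) : f=0\ \ \mu''\text{-a.e.}\},$$ which is a band in $L_p(\mu)$. Then the band projection $P$ onto $M$ is not a multiplication operator, i.e., there exists no locally measurable function $h\colon\Omega\to\mathbb R$ such that $Pf=hf$ for all $f\in L_p(\mu)$.
   Context: Construction of the measure space. Let $\mathfrak c$ denote the cardinality of the continuum, let $\Gamma$ be a set of cardinality greater than $\mathfrak c$, and let $\Omega:=(0,1)\times\Gamma$. Let $\lambda$ be Lebesgue measure on $(0,1)$. On $\Gamma$ use the $\sigma$-algebra of countable and co-countable subsets and the measure $\nu$ with $\nu(G):=0$ if $G\subseteq\Gamma$ is countable and $\nu(G):=1$ if $G\subseteq\Gamma$ is co-countable. For $A\subseteq\Omega$, $x\in(0,1)$, $\gamma\in\Gamma$ put $$A_x:=\{\gamma\in\Gamma : (x,\gamma)\in A\},\qquad A^\gamma:=\{x\in(0,1) : (x,\gamma)\in A\}.$$ Let $\mathcal A$ be the $\sigma$-algebra of all $A\subseteq\Omega$ such that $A_x$ is countable or co-countable for every $x\in(0,1)$ and $A^\gamma$ is a Borel set in $(0,1)$ for every $\gamma\in\Gamma$. For $A\in\mathcal A$ define $$\mu'(A):=\sum_{x\in(0,1)}\nu(A_x),\qquad \mu''(A):=\sum_{\gamma\in\Gamma}\lambda(A^\gamma),\qquad \mu:=\mu'+\mu''.$$ These are measures on $\mathcal A$. $L_p(\mu)$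 consists of (equivalence classes of) real-valued functions. Locally measurable: a function $h\colon\Omega\to\mathbb R$ is locally measurable if $\mathbf 1_A h$ is $\mathcal A$-measurable for all $A\in\mathcal A$ with $\mu(A)<\infty$. Band: a band in a vector lattice $E$ is a lattice ideal $M$ such that $\sup B\in M$ whenever $B\subseteq M$ and $\sup B$ exists in $E$. Every band $M$ in $L_p(\mu)$ is a projection band: $L_p(\mu)=M\oplus M^\perp$, where $M^\perp:=\{f\in L_p(\mu) : |f|\wedge|g|=0\text{ for all }g\in M\}$. The band projection onto $M$ is the projection $P$ of $L_p(\mu)$ onto $M$ along $M^\perp$. *)

theory Defs
  imports "HOL-Analysis.Analysis" "HOL-Library.Equipollence" "HOL-Algebra.Lattice"
begin

text \<open>
  A vector lattice is given by its carrier, its order (whose suprema and infima are those of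
  HOL-Algebra) and its linear operations over the reals.  The record fixes the signature only;
  the field \<open>eq\<close> inherited from \<^type>\<open>gorder\<close> is meant to be equality.
\<close>

record 'a riesz = "'a gorder" +
  vzero :: 'a
  vadd :: "'a \<Rightarrow> 'a \<Rightarrow> 'a"
  vscale :: "real \<Rightarrow> 'a \<Rightarrow> 'a"

definition vabs :: "('a, 'm) riesz_scheme \<Rightarrow> 'a \<Rightarrow> 'a" where
  "vabs E x = x \<squnion>\<^bsub>E\<^esub> vscale E (-1) x"

definition vsubspace :: "('a, 'm) riesz_scheme \<Rightarrow> 'a set \<Rightarrow> bool" where
  "vsubspace E M \<longleftrightarrow> M \<subseteq> carrier E \<and> vzero E \<in> M \<and>
     (\<forall>x\<in>M. \<forall>y\<in>M. vadd E x y \<in> M) \<and> (\<forall>c. \<forall>x\<in>M. vscale E c x \<in> M)"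

definition lattice_ideal :: "('a, 'm) riesz_scheme \<Rightarrow> 'a set \<Rightarrow> bool" where
  "lattice_ideal E M \<longleftrightarrow> vsubspace E M \<and>
     (\<forall>x\<in>carrier E. \<forall>y\<in>M. vabs E x \<sqsubseteq>\<^bsub>E\<^esub> vabs E y \<longrightarrow> x \<in> M)"

definition band :: "('a, 'm) riesz_scheme \<Rightarrow> 'a set \<Rightarrow> bool" where
  "band E M \<longleftrightarrow> lattice_ideal E M \<and>
     (\<forall>B s. B \<subseteq> M \<longrightarrow> least E s (Upper E B) \<longrightarrow> s \<in> M)"

definition disjoint_compl :: "('a, 'm) riesz_scheme \<Rightarrow> 'a set \<Rightarrow> 'a set" where
  "disjoint_compl E M = {x \<in> carrier E. \<forall>y\<in>M. vabs E x \<sqinter>\<^bsub>E\<^esub> vabs E y = vzero E}"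

definition projection_band :: "('a, 'm) riesz_scheme \<Rightarrow> 'a set \<Rightarrow> bool" where
  "projection_band E M \<longleftrightarrow> band E M \<and>
     (\<forall>x\<in>carrier E. \<exists>!w. fst w \<in> M \<and> snd w \<in> disjoint_compl E M \<and> x = vadd E (fst w) (snd w))"

text \<open>Meaningful only for a projection band \<open>M\<close> and arguments in the carrier.\<close>

definition band_projection :: "('a, 'm) riesz_scheme \<Rightarrow> 'a set \<Rightarrow> 'a \<Rightarrow> 'a" where
  "band_projection E M x = (THE y. y \<in> M \<and> (\<exists>z\<in>disjoint_compl E M. x = vadd E y z))"

text \<open>
  Functions are defined on the whole type; their values off \<^term>\<open>space N\<close> affect neither
  measurability, nor integrability, nor equality almost everywhere.
\<close>

definition Lp_fun :: "'a measure \<Rightarrow> real \<Rightarrow> ('a \<Rightarrow> real) set" where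
  "Lp_fun N p = {f \<in> borel_measurable N. integrable N (\<lambda>\<omega>. \<bar>f \<omega>\<bar> powr p)}"

definition Lp_rel :: "'a measure \<Rightarrow> real \<Rightarrow> (('a \<Rightarrow> real) \<times> ('a \<Rightarrow> real)) set" where
  "Lp_rel N p = {(f, g). f \<in> Lp_fun N p \<and> g \<in> Lp_fun N p \<and> (AE \<omega> in N. f \<omega> = g \<omega>)}"

text \<open>The class of \<open>f\<close>; it is empty if \<open>f\<close> is not in \<open>Lp_fun N p\<close>.\<close>

definition Lp_class :: "'a measure \<Rightarrow> real \<Rightarrow> ('a \<Rightarrow> real) \<Rightarrow> ('a \<Rightarrow> real) set" where
  "Lp_class N p f = Lp_rel N p `` {f}"

definition Lp :: "'a measure \<Rightarrow> real \<Rightarrow> ('a \<Rightarrow> real) set riesz" where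
  "Lp N p = \<lparr>
     carrier = Lp_fun N p // Lp_rel N p,
     eq = (=),
     le = (\<lambda>F G. \<exists>f\<in>F. \<exists>g\<in>G. AE \<omega> in N. f \<omega> \<le> g \<omega>),
     vzero = Lp_class N p (\<lambda>\<omega>. 0),
     vadd = (\<lambda>F G. \<Union>f\<in>F. \<Union>g\<in>G. Lp_class N p (\<lambda>\<omega>. f \<omega> + g \<omega>)),
     vscale = (\<lambda>c F. \<Union>f\<in>F. Lp_class N p (\<lambda>\<omega>. c * f \<omega>)) \<rparr>"

definition locally_measurable :: "'a measure \<Rightarrow> ('a \<Rightarrow> real) \<Rightarrow> bool" where
  "locally_measurable N h \<longleftrightarrow>
     (\<forall>A\<in>sets N. emeasure N A < \<infinity> \<longrightarrow> (\<lambda>\<omega>. indicator A \<omega> * h \<omega>) \<in> borel_measurable N)"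

definition cocountable_algebra :: "'g set \<Rightarrow> 'g set set" where
  "cocountable_algebra \<Gamma> = {G. G \<subseteq> \<Gamma> \<and> (countable G \<or> countable (\<Gamma> - G))}"

definition nu :: "'g set \<Rightarrow> 'g measure" where
  "nu \<Gamma> = measure_of \<Gamma> (cocountable_algebra \<Gamma>) (\<lambda>G. if countable G then 0 else 1)"

definition Omega :: "'g set \<Rightarrow> (real \<times> 'g) set" where
  "Omega \<Gamma> = {0<..<1} \<times> \<Gamma>"

abbreviation xslice :: "(real \<times> 'g) set \<Rightarrow> real \<Rightarrow> 'g set" where
  "xslice A x \<equiv> {\<gamma>. (x, \<gamma>) \<in> A}"

abbreviation gslice :: "(real \<times> 'g) set \<Rightarrow> 'g \<Rightarrow> real set" where
  "gslice A \<gamma> \<equiv> {x. (x, \<gamma>) \<in> A}"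

definition slice_algebra :: "'g set \<Rightarrow> (real \<times> 'g) set set" where
  "slice_algebra \<Gamma> = {A. A \<subseteq> Omega \<Gamma> \<and>
     (\<forall>x\<in>{0<..<1}. xslice A x \<in> cocountable_algebra \<Gamma>) \<and> (\<forall>\<gamma>\<in>\<Gamma>. gslice A \<gamma> \<in> sets borel)}"

definition mu1 :: "'g set \<Rightarrow> (real \<times> 'g) measure" where
  "mu1 \<Gamma> = measure_of (Omega \<Gamma>) (slice_algebra \<Gamma>)
     (\<lambda>A. \<Sum>\<^sub>\<infinity>x\<in>{0<..<1}. emeasure (nu \<Gamma>) (xslice A x))"

definition mu2 :: "'g set \<Rightarrow> (real \<times> 'g) measure" where
  "mu2 \<Gamma> = measure_of (Omega \<Gamma>) (slice_algebra \<Gamma>)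
     (\<lambda>A. \<Sum>\<^sub>\<infinity>\<gamma>\<in>\<Gamma>. emeasure lborel (gslice A \<gamma>))"

definition mu :: "'g set \<Rightarrow> (real \<times> 'g) measure" where
  "mu \<Gamma> = measure_of (Omega \<Gamma>) (slice_algebra \<Gamma>)
     (\<lambda>A. emeasure (mu1 \<Gamma>) A + emeasure (mu2 \<Gamma>) A)"

text \<open>
  \<^const>\<open>measure_of\<close> silently yields the zero measure, or a larger \<open>\<sigma>\<close>-algebra, if it is not
  given a measure on a \<open>\<sigma>\<close>-algebra.  The following lemmas show that this does not happen here.
\<close>

lemma sigma_algebra_cocountable: "sigma_algebra \<Gamma> (cocountable_algebra \<Gamma>)"
  unfolding sigma_algebra_iff2
proof (intro conjI allI ballI impI)
  fix A :: "nat \<Rightarrow> _" assume A: "range A \<subseteq> cocountable_algebra \<Gamma>"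
  show "(\<Union>i. A i) \<in> cocountable_algebra \<Gamma>"
  proof (cases "\<forall>i. countable (A i)")
    case True
    then show ?thesis using A by (auto simp: cocountable_algebra_def)
  next
    case False
    then obtain i where "\<not> countable (A i)" by blast
    then have "countable (\<Gamma> - A i)" using A by (auto simp: cocountable_algebra_def)
    then have "countable (\<Gamma> - (\<Union>i. A i))" by (rule countable_subset[rotated]) auto
    then show ?thesis using A by (auto simp: cocountable_algebra_def)
  qed
next
  fix s assume "s \<in> cocountable_algebra \<Gamma>"
  then show "\<Gamma> - s \<in> cocountable_algebra \<Gamma>"
    by (auto simp: cocountable_algebra_def double_diff)
qed (auto simp: cocountable_algebra_def)

lemma sets_nu: "sets (nu \<Gamma>) = cocountable_algebra \<Gamma>"
  unfolding nu_def
  by (simp add: sigma_algebra.sets_measure_of_eq[OF sigma_algebra_cocountable])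

lemma emeasure_nu:
  assumes unc: "\<not> countable \<Gamma>" and G: "G \<in> cocountable_algebra \<Gamma>"
  shows "emeasure (nu \<Gamma>) G = (if countable G then 0 else 1)"
  unfolding nu_def
proof (rule emeasure_measure_of_sigma[OF sigma_algebra_cocountable _ _ G])
  show "positive (cocountable_algebra \<Gamma>) (\<lambda>G. if countable G then 0 else 1)"
    by (auto simp: positive_def)
  show "countably_additive (cocountable_algebra \<Gamma>) (\<lambda>G. if countable G then 0 else 1)"
    unfolding countably_additive_def
  proof (intro allI impI)
    fix A :: "nat \<Rightarrow> _"
    assume A: "range A \<subseteq> cocountable_algebra \<Gamma>" and disj: "disjoint_family A"
    show "(\<Sum>i. if countable (A i) then 0 else (1::ennreal))
            = (if countable (\<Union> (range A)) then 0 else 1)"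
    proof (cases "\<forall>i. countable (A i)")
      case True
      then show ?thesis by simp
    next
      case False
      then obtain i where i: "\<not> countable (A i)" by blast
      then have co: "countable (\<Gamma> - A i)" using A by (auto simp: cocountable_algebra_def)
      have c: "countable (A j)" if "j \<noteq> i" for j
      proof (rule countable_subset[OF _ co])
        show "A j \<subseteq> \<Gamma> - A i"
          using that A disj by (fastforce simp: cocountable_algebra_def disjoint_family_on_def)
      qed
      have "(\<Sum>j. if countable (A j) then 0 else (1::ennreal)) = (\<Sum>j\<in>{i}. if countable (A j) then 0 else 1)"
        by (rule suminf_finite) (auto simp: c)
      moreover have "\<not> countable (\<Union> (range A))"
        using i by (meson UNIV_I UN_upper countable_subset)
      ultimately show ?thesis using i by simp
    qed
  qed
qed

lemma sigma_algebra_slice: "sigma_algebra (Omega \<Gamma>) (slice_algebra \<Gamma>)"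
  unfolding sigma_algebra_iff2
proof (intro conjI allI ballI impI)
  interpret C: sigma_algebra \<Gamma> "cocountable_algebra \<Gamma>" by (rule sigma_algebra_cocountable)
  show "slice_algebra \<Gamma> \<subseteq> Pow (Omega \<Gamma>)" "{} \<in> slice_algebra \<Gamma>"
    by (auto simp: slice_algebra_def)
  fix s assume s: "s \<in> slice_algebra \<Gamma>"
  have x: "xslice (Omega \<Gamma> - s) x = \<Gamma> - xslice s x" if "x \<in> {0<..<1}" for x
    using that by (auto simp: Omega_def)
  have g: "gslice (Omega \<Gamma> - s) \<gamma> = {0<..<1} - gslice s \<gamma>" if "\<gamma> \<in> \<Gamma>" for \<gamma>
    using that by (auto simp: Omega_def)
  show "Omega \<Gamma> - s \<in> slice_algebra \<Gamma>"
    unfolding slice_algebra_def mem_Collect_eq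
  proof (intro conjI ballI)
    fix x :: real assume "x \<in> {0<..<1}"
    then show "xslice (Omega \<Gamma> - s) x \<in> cocountable_algebra \<Gamma>"
      using s by (subst x) (auto simp: slice_algebra_def)
  next
    fix \<gamma> assume "\<gamma> \<in> \<Gamma>"
    then show "gslice (Omega \<Gamma> - s) \<gamma> \<in> sets borel"
      using s by (subst g) (auto simp: slice_algebra_def)
  qed auto
next
  interpret C: sigma_algebra \<Gamma> "cocountable_algebra \<Gamma>" by (rule sigma_algebra_cocountable)
  fix A :: "nat \<Rightarrow> _" assume A: "range A \<subseteq> slice_algebra \<Gamma>"
  have x: "xslice (\<Union>i. A i) x = (\<Union>i. xslice (A i) x)" for x by auto
  have g: "gslice (\<Union>i. A i) \<gamma> = (\<Union>i. gslice (A i) \<gamma>)" for \<gamma> by auto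
  show "(\<Union>i. A i) \<in> slice_algebra \<Gamma>"
    unfolding slice_algebra_def mem_Collect_eq x g
  proof (intro conjI ballI)
    fix x :: real assume "x \<in> {0<..<1}"
    then show "(\<Union>i. xslice (A i) x) \<in> cocountable_algebra \<Gamma>"
      using A by (intro C.countable_UN) (auto simp: slice_algebra_def)
  next
    fix \<gamma> assume "\<gamma> \<in> \<Gamma>"
    then show "(\<Union>i. gslice (A i) \<gamma>) \<in> sets borel"
      using A by (intro sets.countable_UN) (auto simp: slice_algebra_def)
  qed (use A in \<open>auto simp: slice_algebra_def\<close>)
qed

lemma suminf_infsum_swap:
  fixes f :: "nat \<Rightarrow> 'a \<Rightarrow> ennreal"
  shows "(\<Sum>i. infsum (f i) A) = infsum (\<lambda>x. \<Sum>i. f i x) A"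
proof -
  let ?S = "{F. finite F \<and> F \<subseteq> A}"
  have fin: "(\<Sum>i<n. infsum (f i) A) = infsum (\<lambda>x. \<Sum>i<n. f i x) A" for n
  proof (induction n)
    case (Suc n)
    have "infsum (\<lambda>x. (\<Sum>i<n. f i x) + f n x) A = infsum (\<lambda>x. \<Sum>i<n. f i x) A + infsum (f n) A"
      by (rule infsum_add) (auto intro: nonneg_summable_on_complete)
    then show ?case using Suc by simp
  qed simp
  have "(\<Sum>i. infsum (f i) A) = (SUP n. \<Sum>i<n. infsum (f i) A)"
    by (rule suminf_eq_SUP)
  also have "\<dots> = (SUP n. infsum (\<lambda>x. \<Sum>i<n. f i x) A)"
    by (simp only: fin)
  also have "\<dots> = (SUP n. SUP F\<in>?S. \<Sum>x\<in>F. \<Sum>i<n. f i x)"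
    by (simp add: nonneg_infsum_complete)
  also have "\<dots> = (SUP F\<in>?S. SUP n. \<Sum>x\<in>F. \<Sum>i<n. f i x)"
    by (rule SUP_commute)
  also have "\<dots> = (SUP F\<in>?S. SUP n. \<Sum>i<n. \<Sum>x\<in>F. f i x)"
    by (subst sum.swap) simp
  also have "\<dots> = (SUP F\<in>?S. \<Sum>i. \<Sum>x\<in>F. f i x)"
    by (simp add: suminf_eq_SUP)
  also have "\<dots> = (SUP F\<in>?S. \<Sum>x\<in>F. \<Sum>i. f i x)"
    by (subst suminf_sum) auto
  also have "\<dots> = infsum (\<lambda>x. \<Sum>i. f i x) A"
    by (simp add: nonneg_infsum_complete)
  finally show ?thesis .
qed

lemma sets_mu1: "sets (mu1 \<Gamma>) = slice_algebra \<Gamma>"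
  and sets_mu2: "sets (mu2 \<Gamma>) = slice_algebra \<Gamma>"
  and sets_mu: "sets (mu \<Gamma>) = slice_algebra \<Gamma>"
  and space_mu: "space (mu \<Gamma>) = Omega \<Gamma>"
  unfolding mu1_def mu2_def mu_def
  by (simp_all add: sigma_algebra.sets_measure_of_eq[OF sigma_algebra_slice]
      sigma_algebra.space_measure_of_eq[OF sigma_algebra_slice])

lemma emeasure_mu1:
  assumes "A \<in> slice_algebra \<Gamma>"
  shows "emeasure (mu1 \<Gamma>) A = (\<Sum>\<^sub>\<infinity>x\<in>{0<..<1}. emeasure (nu \<Gamma>) (xslice A x))"
  unfolding mu1_def
proof (rule emeasure_measure_of_sigma[OF sigma_algebra_slice _ _ assms])
  show "positive (slice_algebra \<Gamma>) (\<lambda>A. \<Sum>\<^sub>\<infinity>x\<in>{0<..<1}. emeasure (nu \<Gamma>) (xslice A x))"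
    by (auto simp: positive_def)
  show "countably_additive (slice_algebra \<Gamma>) (\<lambda>A. \<Sum>\<^sub>\<infinity>x\<in>{0<..<1}. emeasure (nu \<Gamma>) (xslice A x))"
    unfolding countably_additive_def
  proof (intro allI impI)
    fix B :: "nat \<Rightarrow> _"
    assume B: "range B \<subseteq> slice_algebra \<Gamma>" and disj: "disjoint_family B"
    have "(\<Sum>i. emeasure (nu \<Gamma>) (xslice (B i) x)) = emeasure (nu \<Gamma>) (xslice (\<Union>i. B i) x)"
      if x: "x \<in> {0<..<1}" for x
    proof -
      have eq: "xslice (\<Union>i. B i) x = (\<Union>i. xslice (B i) x)" by auto
      show ?thesis unfolding eq
      proof (rule suminf_emeasure)
        show "range (\<lambda>i. xslice (B i) x) \<subseteq> sets (nu \<Gamma>)"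
          using B x by (auto simp: sets_nu slice_algebra_def)
        show "disjoint_family (\<lambda>i. xslice (B i) x)"
          using disj unfolding disjoint_family_on_def by blast
      qed
    qed
    then show "(\<Sum>i. \<Sum>\<^sub>\<infinity>x\<in>{0<..<1}. emeasure (nu \<Gamma>) (xslice (B i) x))
        = (\<Sum>\<^sub>\<infinity>x\<in>{0<..<1}. emeasure (nu \<Gamma>) (xslice (\<Union> (range B)) x))"
      by (subst suminf_infsum_swap) (rule infsum_cong, simp)
  qed
qed

lemma emeasure_mu2:
  assumes "A \<in> slice_algebra \<Gamma>"
  shows "emeasure (mu2 \<Gamma>) A = (\<Sum>\<^sub>\<infinity>\<gamma>\<in>\<Gamma>. emeasure lborel (gslice A \<gamma>))"
  unfolding mu2_def
proof (rule emeasure_measure_of_sigma[OF sigma_algebra_slice _ _ assms])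
  show "positive (slice_algebra \<Gamma>) (\<lambda>A. \<Sum>\<^sub>\<infinity>\<gamma>\<in>\<Gamma>. emeasure lborel (gslice A \<gamma>))"
    by (auto simp: positive_def)
  show "countably_additive (slice_algebra \<Gamma>) (\<lambda>A. \<Sum>\<^sub>\<infinity>\<gamma>\<in>\<Gamma>. emeasure lborel (gslice A \<gamma>))"
    unfolding countably_additive_def
  proof (intro allI impI)
    fix B :: "nat \<Rightarrow> _"
    assume B: "range B \<subseteq> slice_algebra \<Gamma>" and disj: "disjoint_family B"
    have "(\<Sum>i. emeasure lborel (gslice (B i) \<gamma>)) = emeasure lborel (gslice (\<Union>i. B i) \<gamma>)"
      if \<gamma>: "\<gamma> \<in> \<Gamma>" for \<gamma>
    proof -
      have eq: "gslice (\<Union>i. B i) \<gamma> = (\<Union>i. gslice (B i) \<gamma>)" by auto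
      show ?thesis unfolding eq
      proof (rule suminf_emeasure)
        show "range (\<lambda>i. gslice (B i) \<gamma>) \<subseteq> sets lborel"
          using B \<gamma> by (auto simp: slice_algebra_def)
        show "disjoint_family (\<lambda>i. gslice (B i) \<gamma>)"
          using disj unfolding disjoint_family_on_def by blast
      qed
    qed
    then show "(\<Sum>i. \<Sum>\<^sub>\<infinity>\<gamma>\<in>\<Gamma>. emeasure lborel (gslice (B i) \<gamma>))
        = (\<Sum>\<^sub>\<infinity>\<gamma>\<in>\<Gamma>. emeasure lborel (gslice (\<Union> (range B)) \<gamma>))"
      by (subst suminf_infsum_swap) (rule infsum_cong, simp)
  qed
qed

lemma emeasure_mu:
  assumes "A \<in> slice_algebra \<Gamma>"
  shows "emeasure (mu \<Gamma>) A = emeasure (mu1 \<Gamma>) A + emeasure (mu2 \<Gamma>) A"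
  unfolding mu_def
proof (rule emeasure_measure_of_sigma[OF sigma_algebra_slice _ _ assms])
  show "positive (slice_algebra \<Gamma>) (\<lambda>A. emeasure (mu1 \<Gamma>) A + emeasure (mu2 \<Gamma>) A)"
    by (auto simp: positive_def)
  show "countably_additive (slice_algebra \<Gamma>) (\<lambda>A. emeasure (mu1 \<Gamma>) A + emeasure (mu2 \<Gamma>) A)"
    unfolding countably_additive_def
    by (auto simp: suminf_add[symmetric] sets_mu1 sets_mu2 suminf_emeasure)
qed

end

theory Submission
  imports Defs
begin

text \<open>
  A function \<open>f\<close> in \<open>L\<^sub>p(\<mu>)\<close> lives on countably many sets of finite measure, and a set of finite
  \<open>\<mu>''\<close>-measure has only countably many columns \<open>(0,1) \<times> {\<gamma>}\<close> that it meets in positive Lebesgue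
  measure.  Hence there is a countable \<open>C \<subseteq> \<Gamma>\<close> such that \<open>f = 0\<close> \<open>\<mu>''\<close>-a.e. off \<open>T = (0,1) \<times> C\<close>
  (\<open>split_mu\<close>).  Every slice \<open>T\<^sub>x = C\<close> is countable, so \<open>\<mu>'(T) = 0\<close>.
  Restricting \<open>f\<close> to \<open>T\<close> and to its complement therefore writes \<open>f\<close> as a sum of a function that
  vanishes \<open>\<mu>'\<close>-a.e. and one that vanishes \<open>\<mu>''\<close>-a.e.  Since the \<open>\<mu>\<close>-null sets are those that are
  null for both parts, two such functions are disjoint, and \<open>M\<close> is a projection band whose
  disjoint complement consists of the functions that vanish \<open>\<mu>'\<close>-a.e.  This part of the argument
  rests on the relation between the null sets and on the existence of the sets \<open>T\<close>, which depend
  on \<open>f\<close>; it is carried out for abstract measures in the locale \<open>Lp_split\<close>.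

  Suppose that the projection \<open>P\<close> were multiplication by \<open>h\<close>.  For fixed \<open>x\<close> the set
  \<open>{x} \<times> \<Gamma>\<close> has \<open>\<mu>'\<close>-measure 1 and \<open>\<mu>''\<close>-measure 0, so its indicator is fixed by \<open>P\<close>, and \<open>h(x, \<gamma>) = 1\<close> for
  all but countably many \<open>\<gamma>\<close>.  For fixed \<open>\<gamma>\<close> the set \<open>(0,1) \<times> {\<gamma>}\<close> has \<open>\<mu>'\<close>-measure 0 and
  \<open>\<mu>''\<close>-measure 1, so its indicator is annihilated by \<open>P\<close>, and \<open>h(x, \<gamma>) = 0\<close> for almost all \<open>x\<close>.  A union of continuum many countable sets has at
  most the cardinality of the continuum (\<open>Union_countable_lepoll_real\<close>), hence does not exhaust
  \<open>\<Gamma>\<close>.  So some \<open>\<gamma>\<close> is exceptional for no \<open>x\<close>, which gives \<open>h(x, \<gamma>) = 1\<close> for every \<open>x\<close>, a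
  contradiction.  Thus no single set \<open>T\<close> in the \<open>\<sigma>\<close>-algebra can serve all \<open>f\<close> at once.
\<close>

section \<open>Calculating with classes in \<open>L\<^sub>p\<close>\<close>

lemma mem_Lp_class:
  "g \<in> Lp_class N p f \<longleftrightarrow> f \<in> Lp_fun N p \<and> g \<in> Lp_fun N p \<and> (AE \<omega> in N. f \<omega> = g \<omega>)"
  by (auto simp: Lp_class_def Lp_rel_def)

lemma Lp_class_self: "f \<in> Lp_fun N p \<Longrightarrow> f \<in> Lp_class N p f"
  by (simp add: mem_Lp_class)

lemma Lp_class_eq_iff:
  assumes "f \<in> Lp_fun N p" "g \<in> Lp_fun N p"
  shows "Lp_class N p f = Lp_class N p g \<longleftrightarrow> (AE \<omega> in N. f \<omega> = g \<omega>)"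
proof
  assume "Lp_class N p f = Lp_class N p g"
  then have "g \<in> Lp_class N p f"
    using assms by (simp add: mem_Lp_class)
  then show "AE \<omega> in N. f \<omega> = g \<omega>"
    by (simp add: mem_Lp_class)
next
  assume *: "AE \<omega> in N. f \<omega> = g \<omega>"
  have "(AE \<omega> in N. f \<omega> = k \<omega>) \<longleftrightarrow> (AE \<omega> in N. g \<omega> = k \<omega>)" for k
    using * by (intro eventually_subst) (auto elim: eventually_mono)
  then show "Lp_class N p f = Lp_class N p g"
    using assms by (auto simp: mem_Lp_class)
qed

lemma carrier_Lp: "F \<in> carrier (Lp N p) \<longleftrightarrow> (\<exists>f\<in>Lp_fun N p. F = Lp_class N p f)"
  by (auto simp: Lp_def quotient_def Lp_class_def)

lemma Lp_class_carrier [simp]: "f \<in> Lp_fun N p \<Longrightarrow> Lp_class N p f \<in> carrier (Lp N p)"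
  by (auto simp: carrier_Lp)

lemma Lp_le_iff:
  assumes "f \<in> Lp_fun N p" "g \<in> Lp_fun N p"
  shows "Lp_class N p f \<sqsubseteq>\<^bsub>Lp N p\<^esub> Lp_class N p g \<longleftrightarrow> (AE \<omega> in N. f \<omega> \<le> g \<omega>)"
proof
  assume "Lp_class N p f \<sqsubseteq>\<^bsub>Lp N p\<^esub> Lp_class N p g"
  then obtain f' g' where "AE \<omega> in N. f \<omega> = f' \<omega>" "AE \<omega> in N. g \<omega> = g' \<omega>"
      "AE \<omega> in N. f' \<omega> \<le> g' \<omega>"
    by (auto simp: Lp_def mem_Lp_class)
  then show "AE \<omega> in N. f \<omega> \<le> g \<omega>" by eventually_elim simp
next
  assume "AE \<omega> in N. f \<omega> \<le> g \<omega>"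
  then show "Lp_class N p f \<sqsubseteq>\<^bsub>Lp N p\<^esub> Lp_class N p g"
    using assms unfolding Lp_def
    by (simp, intro bexI[of _ f] bexI[of _ g]) (auto simp: mem_Lp_class)
qed

lemma Lp_fun_dominated:
  assumes p: "0 \<le> p" and f: "f \<in> Lp_fun N p" and g: "g \<in> borel_measurable N"
    and le: "\<And>\<omega>. \<bar>g \<omega>\<bar> \<le> \<bar>f \<omega>\<bar>"
  shows "g \<in> Lp_fun N p"
proof -
  have "integrable N (\<lambda>\<omega>. \<bar>g \<omega>\<bar> powr p)"
  proof (rule Bochner_Integration.integrable_bound)
    show "integrable N (\<lambda>\<omega>. \<bar>f \<omega>\<bar> powr p)" using f by (simp add: Lp_fun_def)
    show "(\<lambda>\<omega>. \<bar>g \<omega>\<bar> powr p) \<in> borel_measurable N" using g by measurable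
    show "AE \<omega> in N. norm (\<bar>g \<omega>\<bar> powr p) \<le> norm (\<bar>f \<omega>\<bar> powr p)"
      using le p by (auto intro!: powr_mono2)
  qed
  then show ?thesis using g by (simp add: Lp_fun_def)
qed

lemma Lp_fun_scale: "f \<in> Lp_fun N p \<Longrightarrow> (\<lambda>\<omega>. c * f \<omega>) \<in> Lp_fun N p"
  by (auto simp: Lp_fun_def abs_mult powr_mult)

lemma Lp_fun_zero: "(\<lambda>\<omega>. 0) \<in> Lp_fun N p"
  by (simp add: Lp_fun_def)

lemma Lp_fun_abs: "f \<in> Lp_fun N p \<Longrightarrow> (\<lambda>\<omega>. \<bar>f \<omega>\<bar>) \<in> Lp_fun N p"
  by (auto simp: Lp_fun_def)

lemma Lp_fun_max_abs:
  assumes p: "0 \<le> p" and f: "f \<in> Lp_fun N p" and g: "g \<in> Lp_fun N p"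
  shows "(\<lambda>\<omega>. max (\<bar>f \<omega>\<bar>) (\<bar>g \<omega>\<bar>)) \<in> Lp_fun N p"
proof -
  have [measurable]: "f \<in> borel_measurable N" "g \<in> borel_measurable N"
    using f g by (auto simp: Lp_fun_def)
  have "integrable N (\<lambda>\<omega>. \<bar>max (\<bar>f \<omega>\<bar>) (\<bar>g \<omega>\<bar>)\<bar> powr p)"
  proof (rule Bochner_Integration.integrable_bound)
    show "integrable N (\<lambda>\<omega>. \<bar>f \<omega>\<bar> powr p + \<bar>g \<omega>\<bar> powr p)"
      using f g by (simp add: Lp_fun_def)
    show "AE \<omega> in N. norm (\<bar>max (\<bar>f \<omega>\<bar>) (\<bar>g \<omega>\<bar>)\<bar> powr p) \<le> norm (\<bar>f \<omega>\<bar> powr p + \<bar>g \<omega>\<bar> powr p)"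
      by (auto simp: max_def)
  qed measurable
  then show ?thesis by (simp add: Lp_fun_def)
qed

text \<open>
  The pointwise bound \<open>\<bar>f + g\<bar> \<le> 2 * max \<bar>f\<bar> \<bar>g\<bar>\<close> stands in for the triangle inequality of the norm.
\<close>

lemma Lp_fun_add:
  assumes p: "0 \<le> p" and f: "f \<in> Lp_fun N p" and g: "g \<in> Lp_fun N p"
  shows "(\<lambda>\<omega>. f \<omega> + g \<omega>) \<in> Lp_fun N p"
proof (rule Lp_fun_dominated[OF p Lp_fun_scale[OF Lp_fun_max_abs[OF p f g], of 2]])
  show "(\<lambda>\<omega>. f \<omega> + g \<omega>) \<in> borel_measurable N"
    using f g by (auto simp: Lp_fun_def)
qed auto

lemma Lp_fun_min_abs:
  assumes p: "0 \<le> p" and f: "f \<in> Lp_fun N p" and g: "g \<in> Lp_fun N p"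
  shows "(\<lambda>\<omega>. min (\<bar>f \<omega>\<bar>) (\<bar>g \<omega>\<bar>)) \<in> Lp_fun N p"
  by (rule Lp_fun_dominated[OF p f]) (use f g in \<open>auto simp: Lp_fun_def\<close>)

lemma Lp_fun_restrict:
  assumes p: "0 \<le> p" and f: "f \<in> Lp_fun N p" and T: "T \<in> sets N"
  shows "(\<lambda>\<omega>. f \<omega> * indicator T \<omega>) \<in> Lp_fun N p"
  by (rule Lp_fun_dominated[OF p f])
    (use f T in \<open>auto simp: Lp_fun_def indicator_def\<close>)

lemma indicator_in_Lp_fun:
  assumes "A \<in> sets N" "emeasure N A < \<infinity>"
  shows "indicator A \<in> Lp_fun N p"
proof -
  have "(\<lambda>\<omega>. \<bar>indicator A \<omega> :: real\<bar> powr p) = indicator A"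
    by (auto simp: indicator_def)
  then show ?thesis using assms by (simp add: Lp_fun_def)
qed

text \<open>
  The operations on classes are unions over all representatives; by well-definedness every member
  of the union is the same class, and the union is over a nonempty family.
\<close>

lemma vadd_Lp:
  assumes p: "0 \<le> p" and f: "f \<in> Lp_fun N p" and g: "g \<in> Lp_fun N p"
  shows "vadd (Lp N p) (Lp_class N p f) (Lp_class N p g) = Lp_class N p (\<lambda>\<omega>. f \<omega> + g \<omega>)"
proof -
  have "Lp_class N p (\<lambda>\<omega>. f' \<omega> + g' \<omega>) = Lp_class N p (\<lambda>\<omega>. f \<omega> + g \<omega>)"
    if "f' \<in> Lp_class N p f" "g' \<in> Lp_class N p g" for f' g'
  proof -
    have "f' \<in> Lp_fun N p" "g' \<in> Lp_fun N p" "AE \<omega> in N. f \<omega> = f' \<omega>" "AE \<omega> in N. g \<omega> = g' \<omega>"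
      using that by (auto simp: mem_Lp_class)
    then show ?thesis
      by (subst Lp_class_eq_iff) (auto intro!: Lp_fun_add p f g)
  qed
  note classes = this
  let ?s = "Lp_class N p (\<lambda>\<omega>. f \<omega> + g \<omega>)"
  have "vadd (Lp N p) (Lp_class N p f) (Lp_class N p g)
      = (\<Union>f'\<in>Lp_class N p f. \<Union>g'\<in>Lp_class N p g. Lp_class N p (\<lambda>\<omega>. f' \<omega> + g' \<omega>))"
    by (simp add: Lp_def)
  also have "\<dots> = (\<Union>f'\<in>Lp_class N p f. \<Union>g'\<in>Lp_class N p g. ?s)"
    by (intro SUP_cong refl classes)
  also have "\<dots> = ?s"
    using Lp_class_self[OF f] Lp_class_self[OF g] by blast
  finally show ?thesis .
qed

lemma vscale_Lp:
  assumes f: "f \<in> Lp_fun N p"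
  shows "vscale (Lp N p) c (Lp_class N p f) = Lp_class N p (\<lambda>\<omega>. c * f \<omega>)"
proof -
  have "Lp_class N p (\<lambda>\<omega>. c * f' \<omega>) = Lp_class N p (\<lambda>\<omega>. c * f \<omega>)"
    if "f' \<in> Lp_class N p f" for f'
  proof -
    have "f' \<in> Lp_fun N p" "AE \<omega> in N. f' \<omega> = f \<omega>"
      using that by (auto simp: mem_Lp_class)
    then show ?thesis
      by (subst Lp_class_eq_iff) (auto intro!: Lp_fun_scale f)
  qed
  note classes = this
  have "vscale (Lp N p) c (Lp_class N p f) = (\<Union>f'\<in>Lp_class N p f. Lp_class N p (\<lambda>\<omega>. c * f' \<omega>))"
    by (simp add: Lp_def)
  also have "\<dots> = (\<Union>f'\<in>Lp_class N p f. Lp_class N p (\<lambda>\<omega>. c * f \<omega>))"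
    by (intro SUP_cong refl classes)
  also have "\<dots> = Lp_class N p (\<lambda>\<omega>. c * f \<omega>)"
    using Lp_class_self[OF f] by blast
  finally show ?thesis .
qed

lemma vzero_Lp: "vzero (Lp N p) = Lp_class N p (\<lambda>\<omega>. 0)"
  by (simp add: Lp_def)

lemma Lp_antisym:
  assumes "F \<in> carrier (Lp N p)" "G \<in> carrier (Lp N p)"
    and "F \<sqsubseteq>\<^bsub>Lp N p\<^esub> G" "G \<sqsubseteq>\<^bsub>Lp N p\<^esub> F"
  shows "F = G"
proof -
  obtain f g where fg: "f \<in> Lp_fun N p" "F = Lp_class N p f" "g \<in> Lp_fun N p" "G = Lp_class N p g"
    using assms(1,2) by (auto simp: carrier_Lp)
  then have "AE \<omega> in N. f \<omega> \<le> g \<omega>" "AE \<omega> in N. g \<omega> \<le> f \<omega>"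
    using assms(3,4) by (auto simp: Lp_le_iff)
  then have "AE \<omega> in N. f \<omega> = g \<omega>" by eventually_elim simp
  then show ?thesis using fg by (simp add: Lp_class_eq_iff)
qed

lemma least_Lp_unique:
  assumes "least (Lp N p) x A" "least (Lp N p) y A"
  shows "x = y"
proof (rule Lp_antisym)
  show "x \<in> carrier (Lp N p)" "y \<in> carrier (Lp N p)"
    using assms unfolding least_def by (meson subsetD)+
  show "x \<sqsubseteq>\<^bsub>Lp N p\<^esub> y" "y \<sqsubseteq>\<^bsub>Lp N p\<^esub> x"
    using assms unfolding least_def by (meson bspec)+
qed

lemma greatest_Lp_unique:
  assumes "greatest (Lp N p) x A" "greatest (Lp N p) y A"
  shows "x = y"
proof (rule Lp_antisym)
  show "x \<in> carrier (Lp N p)" "y \<in> carrier (Lp N p)"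
    using assms unfolding greatest_def by (meson subsetD)+
  show "x \<sqsubseteq>\<^bsub>Lp N p\<^esub> y" "y \<sqsubseteq>\<^bsub>Lp N p\<^esub> x"
    using assms unfolding greatest_def by (meson bspec)+
qed

lemma Upper_pair:
  assumes "a \<in> carrier E" "b \<in> carrier E"
  shows "u \<in> Upper E {a, b} \<longleftrightarrow> u \<in> carrier E \<and> a \<sqsubseteq>\<^bsub>E\<^esub> u \<and> b \<sqsubseteq>\<^bsub>E\<^esub> u"
  using assms by (auto simp: Upper_def)

lemma Lower_pair:
  assumes "a \<in> carrier E" "b \<in> carrier E"
  shows "l \<in> Lower E {a, b} \<longleftrightarrow> l \<in> carrier E \<and> l \<sqsubseteq>\<^bsub>E\<^esub> a \<and> l \<sqsubseteq>\<^bsub>E\<^esub> b"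
  using assms by (auto simp: Lower_def)

text \<open>
  The abstract modulus \<open>x \<squnion> -x\<close> is a choice among least upper bounds; antisymmetry of the order on
  classes makes the choice unique, so that it can be computed pointwise.
\<close>

lemma vabs_Lp:
  assumes f: "f \<in> Lp_fun N p"
  shows "vabs (Lp N p) (Lp_class N p f) = Lp_class N p (\<lambda>\<omega>. \<bar>f \<omega>\<bar>)"
proof -
  define m where "m = (\<lambda>\<omega>. - 1 * f \<omega>)"
  have m: "m \<in> Lp_fun N p" unfolding m_def by (rule Lp_fun_scale[OF f])
  let ?U = "Upper (Lp N p) {Lp_class N p f, Lp_class N p m}"
  have *: "least (Lp N p) (Lp_class N p (\<lambda>\<omega>. \<bar>f \<omega>\<bar>)) ?U"
    unfolding least_def
  proof (intro conjI ballI)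
    show "Lp_class N p (\<lambda>\<omega>. \<bar>f \<omega>\<bar>) \<in> ?U"
      using f m by (auto simp: Upper_pair Lp_fun_abs Lp_le_iff m_def[THEN fun_cong])
  next
    fix G assume G: "G \<in> ?U"
    then obtain g where g: "g \<in> Lp_fun N p" "G = Lp_class N p g"
      by (auto simp: Upper_def carrier_Lp)
    have "AE \<omega> in N. f \<omega> \<le> g \<omega>" "AE \<omega> in N. m \<omega> \<le> g \<omega>"
      using G f g(1) m unfolding g(2) by (simp_all add: Upper_pair Lp_le_iff)
    then have "AE \<omega> in N. \<bar>f \<omega>\<bar> \<le> g \<omega>" by eventually_elim (simp add: m_def)
    then show "Lp_class N p (\<lambda>\<omega>. \<bar>f \<omega>\<bar>) \<sqsubseteq>\<^bsub>Lp N p\<^esub> G"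
      using f g by (simp add: Lp_le_iff Lp_fun_abs)
  qed (auto simp: Upper_def)
  have "x = Lp_class N p (\<lambda>\<omega>. \<bar>f \<omega>\<bar>)" if "least (Lp N p) x ?U" for x
    by (rule least_Lp_unique[OF that *])
  with * show ?thesis
    unfolding vabs_def join_def Lattice.sup_def vscale_Lp[OF f] m_def by (intro some_equality)
qed

lemma meet_abs_Lp:
  assumes p: "0 \<le> p" and f: "f \<in> Lp_fun N p" and g: "g \<in> Lp_fun N p"
  shows "Lp_class N p (\<lambda>\<omega>. \<bar>f \<omega>\<bar>) \<sqinter>\<^bsub>Lp N p\<^esub> Lp_class N p (\<lambda>\<omega>. \<bar>g \<omega>\<bar>)
    = Lp_class N p (\<lambda>\<omega>. min (\<bar>f \<omega>\<bar>) (\<bar>g \<omega>\<bar>))"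
proof -
  let ?L = "Lower (Lp N p) {Lp_class N p (\<lambda>\<omega>. \<bar>f \<omega>\<bar>), Lp_class N p (\<lambda>\<omega>. \<bar>g \<omega>\<bar>)}"
  note mem = Lp_fun_abs[OF f] Lp_fun_abs[OF g] Lp_fun_min_abs[OF p f g]
  have *: "greatest (Lp N p) (Lp_class N p (\<lambda>\<omega>. min (\<bar>f \<omega>\<bar>) (\<bar>g \<omega>\<bar>))) ?L"
    unfolding greatest_def
  proof (intro conjI ballI)
    show "Lp_class N p (\<lambda>\<omega>. min (\<bar>f \<omega>\<bar>) (\<bar>g \<omega>\<bar>)) \<in> ?L"
      using mem by (auto simp: Lower_pair Lp_le_iff)
  next
    fix K assume K: "K \<in> ?L"
    then obtain k where k: "k \<in> Lp_fun N p" "K = Lp_class N p k"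
      by (auto simp: Lower_def carrier_Lp)
    have "AE \<omega> in N. k \<omega> \<le> \<bar>f \<omega>\<bar>" "AE \<omega> in N. k \<omega> \<le> \<bar>g \<omega>\<bar>"
      using K k(1) mem unfolding k(2) by (simp_all add: Lower_pair Lp_le_iff)
    then have "AE \<omega> in N. k \<omega> \<le> min (\<bar>f \<omega>\<bar>) (\<bar>g \<omega>\<bar>)" by eventually_elim auto
    then show "K \<sqsubseteq>\<^bsub>Lp N p\<^esub> Lp_class N p (\<lambda>\<omega>. min (\<bar>f \<omega>\<bar>) (\<bar>g \<omega>\<bar>))"
      using k mem by (simp add: Lp_le_iff)
  qed (auto simp: Lower_def)
  have "x = Lp_class N p (\<lambda>\<omega>. min (\<bar>f \<omega>\<bar>) (\<bar>g \<omega>\<bar>))" if "greatest (Lp N p) x ?L" for x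
    by (rule greatest_Lp_unique[OF that *])
  with * show ?thesis
    unfolding meet_def Lattice.inf_def by (intro some_equality)
qed

lemma disjoint_Lp_iff:
  assumes p: "0 \<le> p" and f: "f \<in> Lp_fun N p" and g: "g \<in> Lp_fun N p"
  shows "vabs (Lp N p) (Lp_class N p f) \<sqinter>\<^bsub>Lp N p\<^esub> vabs (Lp N p) (Lp_class N p g) = vzero (Lp N p)
    \<longleftrightarrow> (AE \<omega> in N. f \<omega> = 0 \<or> g \<omega> = 0)"
proof -
  have min_0: "min (\<bar>a\<bar>) (\<bar>b\<bar>) = 0 \<longleftrightarrow> a = 0 \<or> b = 0" for a b :: real
    by (auto simp: min_def)
  show ?thesis
    unfolding vabs_Lp[OF f] vabs_Lp[OF g] meet_abs_Lp[OF p f g] vzero_Lp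
      Lp_class_eq_iff[OF Lp_fun_min_abs[OF p f g] Lp_fun_zero] min_0 ..
qed

lemma band_projection_eqI:
  assumes "projection_band E M" "x \<in> carrier E"
    and "y \<in> M" "z \<in> disjoint_compl E M" "x = vadd E y z"
  shows "band_projection E M x = y"
  unfolding band_projection_def
proof (rule the_equality)
  show "y \<in> M \<and> (\<exists>z\<in>disjoint_compl E M. x = vadd E y z)" using assms by auto
  fix y' assume "y' \<in> M \<and> (\<exists>z\<in>disjoint_compl E M. x = vadd E y' z)"
  then obtain z' where z': "y' \<in> M" "z' \<in> disjoint_compl E M" "x = vadd E y' z'" by auto
  have "\<exists>!w. fst w \<in> M \<and> snd w \<in> disjoint_compl E M \<and> x = vadd E (fst w) (snd w)"
    using assms(1,2) by (auto simp: projection_band_def)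
  then have "(y', z') = (y, z)"
    by (rule ex1E) (metis assms(3-5) z' fst_conv snd_conv)
  then show "y' = y" by simp
qed

section \<open>Functions vanishing for a part of the measure form a projection band\<close>

text \<open>
  The setting: \<open>N1\<close> and \<open>N2\<close> have together the same negligible sets as \<open>N\<close>, and every \<open>L\<^sub>p\<close>-function can
  be cut along a measurable set into a piece invisible to \<open>N1\<close> and a piece invisible to \<open>N2\<close>.
  The order of the quantifiers matters: if one set served all functions, the band projection would
  be multiplication by an indicator.
\<close>

locale Lp_split =
  fixes N N1 N2 :: "'a measure" and p :: real
  assumes p: "0 \<le> p"
    and AE_iff: "(AE \<omega> in N. P \<omega>) \<longleftrightarrow> (AE \<omega> in N1. P \<omega>) \<and> (AE \<omega> in N2. P \<omega>)"
    and split: "f \<in> Lp_fun N p \<Longrightarrow>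
      \<exists>T\<in>sets N. (AE \<omega> in N1. \<omega> \<notin> T) \<and> (AE \<omega> in N2. \<omega> \<notin> T \<longrightarrow> f \<omega> = 0)"
begin

definition vanishing :: "('a \<Rightarrow> real) set set" where
  "vanishing = {F \<in> carrier (Lp N p). \<forall>f\<in>F. AE \<omega> in N2. f \<omega> = 0}"

lemma class_vanishing_iff:
  assumes "f \<in> Lp_fun N p"
  shows "Lp_class N p f \<in> vanishing \<longleftrightarrow> (AE \<omega> in N2. f \<omega> = 0)"
proof -
  have transfer: "AE \<omega> in N2. g \<omega> = 0" if "AE \<omega> in N2. f \<omega> = 0" "g \<in> Lp_class N p f" for g
  proof -
    have "AE \<omega> in N2. f \<omega> = g \<omega>" using that(2) by (simp add: mem_Lp_class AE_iff)
    with that(1) show ?thesis by eventually_elim simp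
  qed
  then show ?thesis
    unfolding vanishing_def mem_Collect_eq
    using Lp_class_self[OF assms] Lp_class_carrier[OF assms] transfer by blast
qed

lemma vanishingE:
  assumes "F \<in> vanishing"
  obtains f where "f \<in> Lp_fun N p" "F = Lp_class N p f" "AE \<omega> in N2. f \<omega> = 0"
proof -
  obtain f where "f \<in> Lp_fun N p" "F = Lp_class N p f"
    using assms by (auto simp: vanishing_def carrier_Lp)
  then show ?thesis using assms that class_vanishing_iff by auto
qed

lemma split_functions:
  assumes f: "f \<in> Lp_fun N p"
  obtains f1 f2 where "f1 \<in> Lp_fun N p" "f2 \<in> Lp_fun N p" "\<And>\<omega>. f \<omega> = f1 \<omega> + f2 \<omega>"
    "\<And>\<omega>. f1 \<omega> = 0 \<or> f1 \<omega> = f \<omega>" "AE \<omega> in N2. f1 \<omega> = 0" "AE \<omega> in N1. f2 \<omega> = 0"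
proof -
  obtain T where T: "T \<in> sets N" "AE \<omega> in N1. \<omega> \<notin> T" "AE \<omega> in N2. \<omega> \<notin> T \<longrightarrow> f \<omega> = 0"
    using split[OF f] by auto
  let ?f2 = "\<lambda>\<omega>. f \<omega> * indicator T \<omega>"
  let ?f1 = "\<lambda>\<omega>. f \<omega> + - 1 * ?f2 \<omega>"
  show thesis
  proof (rule that[of ?f1 ?f2])
    show "?f2 \<in> Lp_fun N p" by (rule Lp_fun_restrict[OF p f T(1)])
    then show "?f1 \<in> Lp_fun N p" by (intro Lp_fun_add Lp_fun_scale p f)
    show "AE \<omega> in N2. ?f1 \<omega> = 0" using T(3) by eventually_elim (auto simp: indicator_def)
    show "AE \<omega> in N1. ?f2 \<omega> = 0" using T(2) by eventually_elim (auto simp: indicator_def)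
  qed (auto simp: indicator_def)
qed

text \<open>
  If \<open>f\<close> is disjoint from the band, it is disjoint from its own component \<open>f1\<close> in the band; where
  \<open>f1 \<noteq> 0\<close> it coincides with \<open>f\<close>, so \<open>f1\<close> is negligible and only the component invisible to \<open>N1\<close> remains.
\<close>

lemma class_disjoint_compl_iff:
  assumes f: "f \<in> Lp_fun N p"
  shows "Lp_class N p f \<in> disjoint_compl (Lp N p) vanishing \<longleftrightarrow> (AE \<omega> in N1. f \<omega> = 0)"
proof
  assume *: "Lp_class N p f \<in> disjoint_compl (Lp N p) vanishing"
  from f obtain f1 f2 where s: "f1 \<in> Lp_fun N p" "f2 \<in> Lp_fun N p" "\<And>\<omega>. f \<omega> = f1 \<omega> + f2 \<omega>"
    "\<And>\<omega>. f1 \<omega> = 0 \<or> f1 \<omega> = f \<omega>" "AE \<omega> in N2. f1 \<omega> = 0" "AE \<omega> in N1. f2 \<omega> = 0"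
    by (rule split_functions) auto
  have "Lp_class N p f1 \<in> vanishing" using s by (simp add: class_vanishing_iff)
  then have "AE \<omega> in N. f \<omega> = 0 \<or> f1 \<omega> = 0"
    using * disjoint_Lp_iff[OF p f s(1)] by (simp add: disjoint_compl_def)
  then have "AE \<omega> in N1. f \<omega> = 0 \<or> f1 \<omega> = 0" by (simp add: AE_iff)
  with s(6) show "AE \<omega> in N1. f \<omega> = 0" by eventually_elim (use s(3,4) in auto)
next
  assume *: "AE \<omega> in N1. f \<omega> = 0"
  have "vabs (Lp N p) (Lp_class N p f) \<sqinter>\<^bsub>Lp N p\<^esub> vabs (Lp N p) G = vzero (Lp N p)"
    if "G \<in> vanishing" for G
  proof -
    obtain g where g: "g \<in> Lp_fun N p" "G = Lp_class N p g" "AE \<omega> in N2. g \<omega> = 0"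
      using \<open>G \<in> vanishing\<close> by (rule vanishingE)
    have "AE \<omega> in N1. f \<omega> = 0 \<or> g \<omega> = 0" "AE \<omega> in N2. f \<omega> = 0 \<or> g \<omega> = 0"
      using * g(3) by (auto elim: eventually_mono)
    then show ?thesis by (simp add: g disjoint_Lp_iff p f AE_iff)
  qed
  then show "Lp_class N p f \<in> disjoint_compl (Lp N p) vanishing"
    using f by (simp add: disjoint_compl_def)
qed

lemma lattice_ideal_vanishing: "lattice_ideal (Lp N p) vanishing"
  unfolding lattice_ideal_def vsubspace_def
proof (intro conjI ballI allI impI)
  show "vanishing \<subseteq> carrier (Lp N p)" by (auto simp: vanishing_def)
  show "vzero (Lp N p) \<in> vanishing" by (simp add: vzero_Lp class_vanishing_iff Lp_fun_zero)
next
  fix F G assume "F \<in> vanishing" "G \<in> vanishing"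
  then obtain f g where f: "f \<in> Lp_fun N p" "F = Lp_class N p f" "AE \<omega> in N2. f \<omega> = 0"
    and g: "g \<in> Lp_fun N p" "G = Lp_class N p g" "AE \<omega> in N2. g \<omega> = 0"
    by (metis vanishingE)
  have "AE \<omega> in N2. f \<omega> + g \<omega> = 0" using f(3) g(3) by eventually_elim simp
  then show "vadd (Lp N p) F G \<in> vanishing"
    by (simp add: f g vadd_Lp p class_vanishing_iff Lp_fun_add)
next
  fix c F assume "F \<in> vanishing"
  then obtain f where f: "f \<in> Lp_fun N p" "F = Lp_class N p f" "AE \<omega> in N2. f \<omega> = 0"
    by (rule vanishingE)
  have "AE \<omega> in N2. c * f \<omega> = 0" using f(3) by eventually_elim simp
  then show "vscale (Lp N p) c F \<in> vanishing"
    unfolding f(2) vscale_Lp[OF f(1)] class_vanishing_iff[OF Lp_fun_scale[OF f(1)]] .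
next
  fix F G assume F: "F \<in> carrier (Lp N p)" and G: "G \<in> vanishing"
    and le: "vabs (Lp N p) F \<sqsubseteq>\<^bsub>Lp N p\<^esub> vabs (Lp N p) G"
  obtain f where f: "f \<in> Lp_fun N p" "F = Lp_class N p f" using F by (auto simp: carrier_Lp)
  obtain g where g: "g \<in> Lp_fun N p" "G = Lp_class N p g" "AE \<omega> in N2. g \<omega> = 0"
    using G by (rule vanishingE)
  have "AE \<omega> in N. \<bar>f \<omega>\<bar> \<le> \<bar>g \<omega>\<bar>"
    using le by (simp add: f g vabs_Lp Lp_le_iff Lp_fun_abs)
  then have "AE \<omega> in N2. \<bar>f \<omega>\<bar> \<le> \<bar>g \<omega>\<bar>" by (simp add: AE_iff)
  with g(3) have "AE \<omega> in N2. f \<omega> = 0" by eventually_elim simp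
  then show "F \<in> vanishing" by (simp add: f class_vanishing_iff)
qed

text \<open>
  Let \<open>s = s1 + s2\<close> be the supremum of \<open>B\<close>, split so that \<open>s1\<close> vanishes for \<open>N2\<close> and \<open>s2\<close> for \<open>N1\<close>.
  Members of \<open>B\<close> vanish for \<open>N2\<close>, so scaling \<open>s2\<close> by any \<open>c \<ge> 0\<close> still leaves an upper bound.
  Minimality of \<open>s\<close> against \<open>c = 0\<close> gives \<open>s2 \<le> 0\<close>, and against \<open>c = 2\<close> gives \<open>s2 \<ge> 0\<close>.
\<close>

lemma band_vanishing: "band (Lp N p) vanishing"
  unfolding band_def
proof (intro conjI allI impI lattice_ideal_vanishing)
  fix B S assume B: "B \<subseteq> vanishing" and least: "least (Lp N p) S (Upper (Lp N p) B)"
  then have "S \<in> carrier (Lp N p)" by (auto simp: least_def Upper_def)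
  then obtain s where s: "s \<in> Lp_fun N p" "S = Lp_class N p s" by (auto simp: carrier_Lp)
  from s(1) obtain s1 s2 where s12: "s1 \<in> Lp_fun N p" "s2 \<in> Lp_fun N p" "\<And>\<omega>. s \<omega> = s1 \<omega> + s2 \<omega>"
    "\<And>\<omega>. s1 \<omega> = 0 \<or> s1 \<omega> = s \<omega>" "AE \<omega> in N2. s1 \<omega> = 0" "AE \<omega> in N1. s2 \<omega> = 0"
    by (rule split_functions) auto
  have upper: "AE \<omega> in N. s \<omega> \<le> s1 \<omega> + c * s2 \<omega>" if "0 \<le> c" for c
  proof -
    have mem: "(\<lambda>\<omega>. s1 \<omega> + c * s2 \<omega>) \<in> Lp_fun N p"
      by (intro Lp_fun_add Lp_fun_scale p s12)
    have "G \<sqsubseteq>\<^bsub>Lp N p\<^esub> Lp_class N p (\<lambda>\<omega>. s1 \<omega> + c * s2 \<omega>)" if G: "G \<in> B" for G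
    proof -
      obtain g where g: "g \<in> Lp_fun N p" "G = Lp_class N p g" "AE \<omega> in N2. g \<omega> = 0"
        using G B by (blast elim: vanishingE)
      have "G \<sqsubseteq>\<^bsub>Lp N p\<^esub> S"
        using least G g by (auto simp: least_def Upper_def)
      then have "AE \<omega> in N. g \<omega> \<le> s \<omega>" using s g by (simp add: Lp_le_iff)
      then have "AE \<omega> in N1. g \<omega> \<le> s \<omega>" "AE \<omega> in N2. g \<omega> \<le> s \<omega>" by (auto simp: AE_iff)
      have "AE \<omega> in N1. g \<omega> \<le> s1 \<omega> + c * s2 \<omega>"
        using \<open>AE \<omega> in N1. g \<omega> \<le> s \<omega>\<close> s12(6) by eventually_elim (simp add: s12(3))
      moreover have "AE \<omega> in N2. g \<omega> \<le> s1 \<omega> + c * s2 \<omega>"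
        using \<open>AE \<omega> in N2. g \<omega> \<le> s \<omega>\<close> s12(5) g(3)
        by eventually_elim (use \<open>0 \<le> c\<close> in \<open>simp add: s12(3)\<close>)
      ultimately show ?thesis using g mem by (simp add: Lp_le_iff AE_iff)
    qed
    then have "Lp_class N p (\<lambda>\<omega>. s1 \<omega> + c * s2 \<omega>) \<in> Upper (Lp N p) B"
      using mem by (auto simp: Upper_def)
    then show ?thesis using least s mem by (auto simp: least_def Lp_le_iff)
  qed
  have "AE \<omega> in N. s2 \<omega> = 0"
    using upper[of 0, simplified] upper[of 2, simplified] by eventually_elim (simp add: s12(3))
  then have "AE \<omega> in N2. s2 \<omega> = 0" by (simp add: AE_iff)
  with s12(5) have "AE \<omega> in N2. s \<omega> = 0" by eventually_elim (simp add: s12(3))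
  then show "S \<in> vanishing" using s by (simp add: class_vanishing_iff)
qed

lemma projection_band_vanishing: "projection_band (Lp N p) vanishing"
  unfolding projection_band_def
proof (intro conjI ballI band_vanishing)
  fix F assume "F \<in> carrier (Lp N p)"
  then obtain f where f: "f \<in> Lp_fun N p" "F = Lp_class N p f" by (auto simp: carrier_Lp)
  from f(1) obtain f1 f2 where s: "f1 \<in> Lp_fun N p" "f2 \<in> Lp_fun N p" "\<And>\<omega>. f \<omega> = f1 \<omega> + f2 \<omega>"
    "AE \<omega> in N2. f1 \<omega> = 0" "AE \<omega> in N1. f2 \<omega> = 0"
    by (rule split_functions) auto
  show "\<exists>!w. fst w \<in> vanishing \<and> snd w \<in> disjoint_compl (Lp N p) vanishing
      \<and> F = vadd (Lp N p) (fst w) (snd w)"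
  proof (rule ex1I[of _ "(Lp_class N p f1, Lp_class N p f2)"])
    have "F = vadd (Lp N p) (Lp_class N p f1) (Lp_class N p f2)"
      unfolding f(2) vadd_Lp[OF p s(1,2)] s(3)[symmetric] ..
    then show "fst (Lp_class N p f1, Lp_class N p f2) \<in> vanishing
        \<and> snd (Lp_class N p f1, Lp_class N p f2) \<in> disjoint_compl (Lp N p) vanishing
        \<and> F = vadd (Lp N p) (fst (Lp_class N p f1, Lp_class N p f2))
            (snd (Lp_class N p f1, Lp_class N p f2))"
      using s(1,2,4,5) by (simp add: class_vanishing_iff class_disjoint_compl_iff)
  next
    fix w assume w: "fst w \<in> vanishing \<and> snd w \<in> disjoint_compl (Lp N p) vanishing
      \<and> F = vadd (Lp N p) (fst w) (snd w)"
    obtain g1 where g1: "g1 \<in> Lp_fun N p" "fst w = Lp_class N p g1" "AE \<omega> in N2. g1 \<omega> = 0"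
      using conjunct1[OF w] by (rule vanishingE)
    obtain g2 where g2: "g2 \<in> Lp_fun N p" "snd w = Lp_class N p g2"
      using w by (auto simp: disjoint_compl_def carrier_Lp)
    then have g2': "AE \<omega> in N1. g2 \<omega> = 0" using w by (simp add: class_disjoint_compl_iff)
    have "AE \<omega> in N. f \<omega> = g1 \<omega> + g2 \<omega>"
      using w f g1 g2 p by (simp add: vadd_Lp Lp_fun_add Lp_class_eq_iff)
    then have f1: "AE \<omega> in N1. f \<omega> = g1 \<omega> + g2 \<omega>" and f2: "AE \<omega> in N2. f \<omega> = g1 \<omega> + g2 \<omega>"
      by (auto simp: AE_iff)
    from f1 g2' s(5) have "AE \<omega> in N1. g1 \<omega> = f1 \<omega> \<and> g2 \<omega> = f2 \<omega>"
      by eventually_elim (simp add: s(3))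
    moreover from f2 g1(3) s(4) have "AE \<omega> in N2. g1 \<omega> = f1 \<omega> \<and> g2 \<omega> = f2 \<omega>"
      by eventually_elim (simp add: s(3))
    ultimately have "AE \<omega> in N. g1 \<omega> = f1 \<omega>" "AE \<omega> in N. g2 \<omega> = f2 \<omega>"
      unfolding AE_iff by (auto elim: eventually_mono)
    then show "w = (Lp_class N p f1, Lp_class N p f2)"
      using g1 g2 s by (simp add: prod_eq_iff Lp_class_eq_iff)
  qed
qed

lemma band_projection_vanishing:
  assumes f: "f \<in> Lp_fun N p"
  shows "AE \<omega> in N2. f \<omega> = 0 \<Longrightarrow> band_projection (Lp N p) vanishing (Lp_class N p f) = Lp_class N p f"
    and "AE \<omega> in N1. f \<omega> = 0 \<Longrightarrow>
      band_projection (Lp N p) vanishing (Lp_class N p f) = Lp_class N p (\<lambda>\<omega>. 0)"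
proof -
  note * = f Lp_fun_zero class_vanishing_iff class_disjoint_compl_iff vadd_Lp p
  show "band_projection (Lp N p) vanishing (Lp_class N p f) = Lp_class N p f"
    if "AE \<omega> in N2. f \<omega> = 0"
    by (rule band_projection_eqI[OF projection_band_vanishing, where z = "Lp_class N p (\<lambda>\<omega>. 0)"])
      (use that in \<open>simp_all add: *\<close>)
  show "band_projection (Lp N p) vanishing (Lp_class N p f) = Lp_class N p (\<lambda>\<omega>. 0)"
    if "AE \<omega> in N1. f \<omega> = 0"
    by (rule band_projection_eqI[OF projection_band_vanishing, where z = "Lp_class N p f"])
      (use that in \<open>simp_all add: *\<close>)
qed

end

section \<open>The two parts of the measure\<close>

text \<open>
  Infinitely many terms above a common positive bound would make the sum infinite, so only finitely
  many terms exceed each \<open>1/(n+1)\<close>.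
\<close>

lemma countable_support_infsum_ennreal:
  fixes e :: "'a \<Rightarrow> ennreal"
  assumes fin: "infsum e A < \<infinity>"
  shows "countable {x\<in>A. e x \<noteq> 0}"
proof -
  have "finite {x\<in>A. ennreal (1 / real (Suc n)) \<le> e x}" (is "finite ?A") for n
  proof (rule ccontr)
    assume inf: "infinite ?A"
    have "infsum e ?A = \<infinity>"
      by (rule infsum_superconst_infinite_ennreal[OF _ _ inf, of "ennreal (1 / real (Suc n))"]) auto
    moreover have "infsum e ?A \<le> infsum e A"
      by (rule infsum_mono_neutral) (auto intro: nonneg_summable_on_complete)
    ultimately show False using fin by simp
  qed
  then have "countable (\<Union>n. {x\<in>A. ennreal (1 / real (Suc n)) \<le> e x})"
    by (intro countable_UN) (auto intro: countable_finite)
  moreover have "{x\<in>A. e x \<noteq> 0} \<subseteq> (\<Union>n. {x\<in>A. ennreal (1 / real (Suc n)) \<le> e x})"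
  proof
    fix x assume "x \<in> {x\<in>A. e x \<noteq> 0}"
    then have x: "x \<in> A" "0 < e x" by (auto simp: zero_less_iff_neq_zero)
    obtain t where t: "0 < t" "t < e x" using dense[OF x(2)] by blast
    then obtain r where "t = ennreal r" by (cases t) auto
    with t have r: "0 < r" "ennreal r < e x" by auto
    obtain n where "1 / real (Suc n) < r" using r(1) nat_approx_posE by blast
    then have "ennreal (1 / real (Suc n)) \<le> e x" using r by (meson ennreal_leI less_imp_le order_trans)
    then show "x \<in> (\<Union>n. {x\<in>A. ennreal (1 / real (Suc n)) \<le> e x})" using x by blast
  qed
  ultimately show ?thesis by (rule countable_subset[rotated])
qed

lemma le_infsum_ennreal:
  fixes e :: "'a \<Rightarrow> ennreal"
  assumes "x \<in> A"
  shows "e x \<le> infsum e A"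
proof -
  have "infsum e {x} \<le> infsum e A"
    using assms by (intro infsum_mono_neutral nonneg_summable_on_complete) auto
  then show ?thesis by simp
qed

lemma infsum_single_ennreal:
  assumes "x \<in> A"
  shows "infsum (\<lambda>y. if y = x then 1 else 0 :: ennreal) A = 1"
proof -
  have "infsum (\<lambda>y. if y = x then 1 else 0 :: ennreal) A = infsum (\<lambda>y. 1) {x}"
    using assms by (intro infsum_cong_neutral) auto
  then show ?thesis by simp
qed

text \<open>
  Exceptional sets for the two parts may differ, but the intersection of a \<open>\<mu>'\<close>-null cover and a
  \<open>\<mu>''\<close>-null cover is \<open>\<mu>\<close>-null and still covers; hence this holds for nonmeasurable \<open>P\<close>, too.
\<close>

lemma AE_mu_iff:
  "(AE \<omega> in mu \<Gamma>. P \<omega>) \<longleftrightarrow> (AE \<omega> in mu1 \<Gamma>. P \<omega>) \<and> (AE \<omega> in mu2 \<Gamma>. P \<omega>)"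
proof -
  have space: "space (mu1 \<Gamma>) = space (mu \<Gamma>)" "space (mu2 \<Gamma>) = space (mu \<Gamma>)"
    by (auto intro!: sets_eq_imp_space_eq simp: sets_mu sets_mu1 sets_mu2)
  have null: "null_sets (mu \<Gamma>) = null_sets (mu1 \<Gamma>) \<inter> null_sets (mu2 \<Gamma>)"
    by (auto simp: null_sets_def sets_mu sets_mu1 sets_mu2 emeasure_mu)
  show ?thesis
  proof
    assume "AE \<omega> in mu \<Gamma>. P \<omega>"
    then show "(AE \<omega> in mu1 \<Gamma>. P \<omega>) \<and> (AE \<omega> in mu2 \<Gamma>. P \<omega>)"
      unfolding eventually_ae_filter null space by blast
  next
    assume "(AE \<omega> in mu1 \<Gamma>. P \<omega>) \<and> (AE \<omega> in mu2 \<Gamma>. P \<omega>)"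
    then obtain A1 A2 where A: "A1 \<in> null_sets (mu1 \<Gamma>)" "A2 \<in> null_sets (mu2 \<Gamma>)"
      "{\<omega> \<in> space (mu \<Gamma>). \<not> P \<omega>} \<subseteq> A1 \<inter> A2"
      unfolding eventually_ae_filter space by blast
    have "A1 \<in> sets (mu2 \<Gamma>)" "A2 \<in> sets (mu1 \<Gamma>)"
      using A by (auto simp: null_sets_def sets_mu1 sets_mu2)
    then have "A1 \<inter> A2 \<in> null_sets (mu \<Gamma>)"
      unfolding null using A by (auto intro: null_set_Int2 null_set_Int1)
    then show "AE \<omega> in mu \<Gamma>. P \<omega>"
      using A(3) unfolding eventually_ae_filter by blast
  qed
qed

context
  fixes \<Gamma> :: "'g set"
  assumes unc: "\<not> countable \<Gamma>"
begin

lemma columns_in_algebra: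
  assumes "C \<subseteq> \<Gamma>" "countable C"
  shows "{0<..<1} \<times> C \<in> slice_algebra \<Gamma>"
  using assms by (auto simp: slice_algebra_def Omega_def cocountable_algebra_def)

lemma mu1_columns:
  assumes C: "C \<subseteq> \<Gamma>" "countable C"
  shows "emeasure (mu1 \<Gamma>) ({0<..<1} \<times> C) = 0"
proof -
  have "emeasure (nu \<Gamma>) (xslice ({0<..<1} \<times> C) x) = 0" if "x \<in> {0<..<1}" for x
    using that C unc by (simp add: emeasure_nu cocountable_algebra_def)
  then show ?thesis
    unfolding emeasure_mu1[OF columns_in_algebra[OF C]] by (rule infsum_0)
qed

text \<open>
  By Markov's inequality the level sets \<open>A n\<close>, which exhaust the support of \<open>f\<close>, have finite measure;
  so each of them charges only countably many columns.  These columns together form \<open>T\<close>.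
\<close>

lemma split_mu:
  assumes f: "f \<in> Lp_fun (mu \<Gamma>) p"
  shows "\<exists>T\<in>sets (mu \<Gamma>). (AE \<omega> in mu1 \<Gamma>. \<omega> \<notin> T) \<and> (AE \<omega> in mu2 \<Gamma>. \<omega> \<notin> T \<longrightarrow> f \<omega> = 0)"
proof -
  have [measurable]: "f \<in> borel_measurable (mu \<Gamma>)" using f by (simp add: Lp_fun_def)
  define A where "A n = {\<omega> \<in> space (mu \<Gamma>). 1 / real (Suc n) \<le> \<bar>f \<omega>\<bar> powr p}" for n
  have A_sets: "A n \<in> slice_algebra \<Gamma>" for n
  proof -
    have "A n \<in> sets (mu \<Gamma>)" unfolding A_def by measurable
    then show ?thesis by (simp add: sets_mu)
  qed
  have A_fin: "emeasure (mu2 \<Gamma>) (A n) < \<infinity>" for n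
  proof -
    have "emeasure (mu \<Gamma>) (A n)
        \<le> ennreal (1 / (1 / real (Suc n)) * (\<integral>\<omega>. \<bar>f \<omega>\<bar> powr p \<partial>mu \<Gamma>))"
      unfolding A_def using f by (intro integral_Markov_inequality) (auto simp: Lp_fun_def)
    then have "emeasure (mu \<Gamma>) (A n) < \<infinity>"
      using ennreal_less_top le_less_trans by (metis infinity_ennreal_def)
    then show ?thesis by (simp add: emeasure_mu A_sets)
  qed
  define C where "C = (\<Union>n. {\<gamma>\<in>\<Gamma>. emeasure lborel (gslice (A n) \<gamma>) \<noteq> 0})"
  have C: "C \<subseteq> \<Gamma>" "countable C"
    using A_fin unfolding C_def
    by (auto simp: emeasure_mu2 A_sets intro!: countable_support_infsum_ennreal)
  let ?T = "{0<..<1} \<times> C"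
  have T: "?T \<in> slice_algebra \<Gamma>" by (rule columns_in_algebra[OF C])
  have diff: "A n - ?T \<in> slice_algebra \<Gamma>" for n
    using A_sets T by (metis sets.Diff sets_mu)
  have "emeasure (mu2 \<Gamma>) (A n - ?T) = 0" for n
  proof -
    have "emeasure lborel (gslice (A n - ?T) \<gamma>) = 0" if \<gamma>: "\<gamma> \<in> \<Gamma>" for \<gamma>
    proof (cases "\<gamma> \<in> C")
      case True
      then have "gslice (A n - ?T) \<gamma> = {}"
        by (auto simp: A_def space_mu Omega_def)
      then show ?thesis by (metis emeasure_empty)
    next
      case False
      then have "gslice (A n - ?T) \<gamma> = gslice (A n) \<gamma>" by auto
      moreover have "emeasure lborel (gslice (A n) \<gamma>) = 0"
        using False \<gamma> unfolding C_def by blast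
      ultimately show ?thesis by metis
    qed
    then show ?thesis unfolding emeasure_mu2[OF diff] by (rule infsum_0)
  qed
  then have "AE \<omega> in mu2 \<Gamma>. \<forall>n. \<omega> \<notin> A n - ?T"
    unfolding AE_all_countable
    by (intro allI AE_not_in) (simp add: null_sets_def sets_mu2 diff)
  moreover have "AE \<omega> in mu2 \<Gamma>. \<omega> \<in> space (mu \<Gamma>)"
    using AE_space[of "mu2 \<Gamma>"] sets_eq_imp_space_eq[of "mu2 \<Gamma>" "mu \<Gamma>"]
    by (simp add: sets_mu sets_mu2)
  ultimately have "AE \<omega> in mu2 \<Gamma>. \<omega> \<notin> ?T \<longrightarrow> f \<omega> = 0"
  proof eventually_elim
    case (elim \<omega>)
    show ?case
    proof (intro impI, rule ccontr)
      assume "\<omega> \<notin> ?T" "f \<omega> \<noteq> 0"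
      then have "0 < \<bar>f \<omega>\<bar> powr p" by simp
      then obtain n where "1 / real (Suc n) < \<bar>f \<omega>\<bar> powr p" using nat_approx_posE by blast
      then have "\<omega> \<in> A n" using elim(2) by (simp add: A_def)
      then show False using elim(1) \<open>\<omega> \<notin> ?T\<close> by auto
    qed
  qed
  moreover have "AE \<omega> in mu1 \<Gamma>. \<omega> \<notin> ?T"
    by (intro AE_not_in) (simp add: null_sets_def sets_mu1 T mu1_columns C)
  ultimately show ?thesis using T by (auto simp: sets_mu)
qed

lemma row:
  assumes "x \<in> {0<..<1}"
  shows "{x} \<times> \<Gamma> \<in> slice_algebra \<Gamma>" "emeasure (mu1 \<Gamma>) ({x} \<times> \<Gamma>) = 1"
    "emeasure (mu2 \<Gamma>) ({x} \<times> \<Gamma>) = 0"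
proof -
  have xs: "xslice ({x} \<times> \<Gamma>) y = (if y = x then \<Gamma> else {})" for y by auto
  have gs: "gslice ({x} \<times> \<Gamma>) \<gamma> = (if \<gamma> \<in> \<Gamma> then {x} else {})" for \<gamma> by auto
  show row: "{x} \<times> \<Gamma> \<in> slice_algebra \<Gamma>"
    using assms unfolding slice_algebra_def mem_Collect_eq xs gs by (auto simp: Omega_def cocountable_algebra_def)
  have "\<Gamma> \<in> cocountable_algebra \<Gamma>" by (simp add: cocountable_algebra_def)
  then have "emeasure (nu \<Gamma>) (xslice ({x} \<times> \<Gamma>) y) = (if y = x then 1 else 0)" for y
    unfolding xs using unc by (simp add: emeasure_nu)
  then show "emeasure (mu1 \<Gamma>) ({x} \<times> \<Gamma>) = 1"
    unfolding emeasure_mu1[OF row] by (simp only: infsum_single_ennreal[OF assms])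
  show "emeasure (mu2 \<Gamma>) ({x} \<times> \<Gamma>) = 0"
    unfolding emeasure_mu2[OF row] gs by (rule infsum_0) simp
qed

lemma column:
  assumes "\<gamma> \<in> \<Gamma>"
  shows "{0<..<1} \<times> {\<gamma>} \<in> slice_algebra \<Gamma>" "emeasure (mu1 \<Gamma>) ({0<..<1} \<times> {\<gamma>}) = 0"
    "emeasure (mu2 \<Gamma>) ({0<..<1} \<times> {\<gamma>}) = 1"
proof -
  show c: "{0<..<1} \<times> {\<gamma>} \<in> slice_algebra \<Gamma>" "emeasure (mu1 \<Gamma>) ({0<..<1} \<times> {\<gamma>}) = 0"
    using assms by (auto intro: columns_in_algebra mu1_columns)
  have "gslice ({0<..<1} \<times> {\<gamma>}) \<delta> = (if \<delta> = \<gamma> then {0<..<1} else {})" for \<delta> by auto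
  then have "emeasure lborel (gslice ({0<..<1} \<times> {\<gamma>}) \<delta>) = (if \<delta> = \<gamma> then 1 else 0)" for \<delta>
    by (simp only: if_distrib[of "emeasure lborel"]) simp
  then show "emeasure (mu2 \<Gamma>) ({0<..<1} \<times> {\<gamma>}) = 1"
    unfolding emeasure_mu2[OF c(1)] by (simp only: infsum_single_ennreal[OF assms])
qed

lemma null_set_mu_slices:
  assumes A: "A \<in> null_sets (mu \<Gamma>)"
  shows "x \<in> {0<..<1} \<Longrightarrow> countable (xslice A x)"
    and "\<gamma> \<in> \<Gamma> \<Longrightarrow> emeasure lborel (gslice A \<gamma>) = 0"
proof -
  have s: "A \<in> slice_algebra \<Gamma>" and "emeasure (mu \<Gamma>) A = 0"
    using A by (auto simp: null_sets_def sets_mu)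
  then have 0: "(\<Sum>\<^sub>\<infinity>x\<in>{0<..<1}. emeasure (nu \<Gamma>) (xslice A x)) = 0"
    "(\<Sum>\<^sub>\<infinity>\<gamma>\<in>\<Gamma>. emeasure lborel (gslice A \<gamma>)) = 0"
    by (simp_all add: emeasure_mu emeasure_mu1 emeasure_mu2)
  show "countable (xslice A x)" if x: "x \<in> {0<..<1}"
  proof -
    have "emeasure (nu \<Gamma>) (xslice A x) \<le> (\<Sum>\<^sub>\<infinity>x\<in>{0<..<1}. emeasure (nu \<Gamma>) (xslice A x))"
      using x by (rule le_infsum_ennreal)
    moreover have "xslice A x \<in> cocountable_algebra \<Gamma>"
      using s x by (auto simp: slice_algebra_def)
    ultimately show ?thesis using 0 unc by (auto simp: emeasure_nu split: if_splits)
  qed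
  show "emeasure lborel (gslice A \<gamma>) = 0" if \<gamma>: "\<gamma> \<in> \<Gamma>"
    using le_infsum_ennreal[OF \<gamma>, of "\<lambda>\<gamma>. emeasure lborel (gslice A \<gamma>)"] 0 by simp
qed

end

section \<open>The band projection is not a multiplication operator\<close>

text \<open>
  Enumerating each \<open>G x\<close> parametrizes the union by \<open>(0,1) \<times> \<nat>\<close>, and \<open>(x, n) \<mapsto> x + n\<close> embeds this
  product into the reals.
\<close>

lemma Union_countable_lepoll_real:
  fixes G :: "real \<Rightarrow> 'g set"
  assumes "\<And>x. x \<in> {0<..<1} \<Longrightarrow> countable (G x)"
  shows "(\<Union>x\<in>{0<..<1}. G x) \<lesssim> (UNIV :: real set)"
proof -
  let ?S = "{0<..<1::real} \<times> (UNIV :: nat set)"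
  have "(\<Union>x\<in>{0<..<1}. G x) \<subseteq> (\<lambda>(x, n). from_nat_into (G x) n) ` ?S"
  proof
    fix \<gamma> assume "\<gamma> \<in> (\<Union>x\<in>{0<..<1}. G x)"
    then obtain x where x: "x \<in> {0<..<1}" "\<gamma> \<in> G x" by auto
    then obtain n where "from_nat_into (G x) n = \<gamma>"
      using from_nat_into_surj[OF assms] by blast
    then show "\<gamma> \<in> (\<lambda>(x, n). from_nat_into (G x) n) ` ?S" using x(1) by force
  qed
  then have "(\<Union>x\<in>{0<..<1}. G x) \<lesssim> (\<lambda>(x, n). from_nat_into (G x) n) ` ?S"
    by (rule subset_imp_lepoll)
  also have "\<dots> \<lesssim> ?S" by (rule image_lepoll)
  also have "\<dots> \<lesssim> (UNIV :: real set)"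
  proof -
    have "inj_on (\<lambda>(x, n). x + real n) ?S"
    proof (rule inj_onI, clarify)
      fix x y :: real and m n :: nat
      assume "x \<in> {0<..<1}" "y \<in> {0<..<1}" and eq: "x + real m = y + real n"
      then have "real m < real n + 1" "real n < real m + 1" by auto
      then have "m = n" by linarith
      then show "x = y \<and> m = n" using eq by simp
    qed
    then show ?thesis unfolding lepoll_def by blast
  qed
  finally show ?thesis .
qed

theorem proposition3p1:
  fixes \<Gamma> :: "'g set" and p :: real
    and E :: "(real \<times> 'g \<Rightarrow> real) set riesz"
    and M :: "(real \<times> 'g \<Rightarrow> real) set set"
  assumes "(UNIV :: real set) \<prec> \<Gamma>"
    and "1 \<le> p"
    and "E = Lp (mu \<Gamma>) p"
    and "M = {F \<in> carrier E. \<forall>f\<in>F. AE \<omega> in mu2 \<Gamma>. f \<omega> = 0}"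
  shows "projection_band E M \<and>
    \<not> (\<exists>h. locally_measurable (mu \<Gamma>) h \<and>
          (\<forall>F\<in>carrier E. \<forall>f\<in>F.
             band_projection E M F = Lp_class (mu \<Gamma>) p (\<lambda>\<omega>. h \<omega> * f \<omega>)))"
proof -
  have not_le: "\<not> \<Gamma> \<lesssim> (UNIV :: real set)"
    using assms(1) by (auto simp: lesspoll_def dest: lepoll_antisym)
  have unc: "\<not> countable \<Gamma>"
  proof
    assume "countable \<Gamma>"
    then have "(\<Union>x\<in>{0<..<1::real}. \<Gamma>) \<lesssim> (UNIV :: real set)"
      by (intro Union_countable_lepoll_real)
    moreover have "(\<Union>x\<in>{0<..<1::real}. \<Gamma>) = \<Gamma>" by (auto intro: exI[of _ "1/2"])
    ultimately show False using not_le by simp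
  qed
  interpret Lp_split "mu \<Gamma>" "mu1 \<Gamma>" "mu2 \<Gamma>" p
    using assms(2) by unfold_locales (auto simp: AE_mu_iff intro: split_mu[OF unc])
  have M: "M = vanishing" using assms(3,4) by (simp add: vanishing_def)
  have False if h: "\<And>F f. F \<in> carrier E \<Longrightarrow> f \<in> F \<Longrightarrow>
      band_projection E M F = Lp_class (mu \<Gamma>) p (\<lambda>\<omega>. h \<omega> * f \<omega>)" for h
  proof -
    \<comment> \<open>As \<open>g\<close> is \<open>p\<close>-integrable its class is nonempty; so \<open>h f\<close> is \<open>p\<close>-integrable, and both agree a.e.\<close>
    have proj: "AE \<omega> in mu \<Gamma>. h \<omega> * f \<omega> = g \<omega>"
      if f: "f \<in> Lp_fun (mu \<Gamma>) p" and g: "g \<in> Lp_fun (mu \<Gamma>) p"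
        and "band_projection E M (Lp_class (mu \<Gamma>) p f) = Lp_class (mu \<Gamma>) p g" for f g
    proof -
      have "Lp_class (mu \<Gamma>) p g = Lp_class (mu \<Gamma>) p (\<lambda>\<omega>. h \<omega> * f \<omega>)"
        using h[of "Lp_class (mu \<Gamma>) p f" f] that by (simp add: assms(3) mem_Lp_class)
      moreover have "g \<in> Lp_class (mu \<Gamma>) p g" using g by (simp add: mem_Lp_class)
      ultimately show ?thesis by (simp add: mem_Lp_class)
    qed
    have row_h: "countable {\<gamma>\<in>\<Gamma>. h (x, \<gamma>) \<noteq> 1}" if x: "x \<in> {0<..<1}" for x
    proof -
      let ?f = "indicator ({x} \<times> \<Gamma>) :: real \<times> 'g \<Rightarrow> real"
      note r = row[OF unc x]
      have f: "?f \<in> Lp_fun (mu \<Gamma>) p"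
        using r by (intro indicator_in_Lp_fun) (auto simp: sets_mu emeasure_mu)
      have "AE \<omega> in mu2 \<Gamma>. \<omega> \<notin> {x} \<times> \<Gamma>"
        using r by (intro AE_not_in) (simp add: null_sets_def sets_mu2)
      then have "AE \<omega> in mu2 \<Gamma>. ?f \<omega> = 0" by eventually_elim simp
      then have "AE \<omega> in mu \<Gamma>. h \<omega> * ?f \<omega> = ?f \<omega>"
        using band_projection_vanishing(1)[OF f] by (intro proj f) (simp add: M assms(3))
      then obtain A where A: "A \<in> null_sets (mu \<Gamma>)"
        "{\<omega> \<in> Omega \<Gamma>. h \<omega> * ?f \<omega> \<noteq> ?f \<omega>} \<subseteq> A"
        by (auto simp: eventually_ae_filter space_mu)
      have "{\<gamma>\<in>\<Gamma>. h (x, \<gamma>) \<noteq> 1} \<subseteq> xslice A x"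
        using A(2) x by (auto simp: Omega_def subset_iff)
      then show ?thesis
        using null_set_mu_slices(1)[OF unc A(1) x] countable_subset by blast
    qed
    have column_h: "emeasure lborel {x \<in> {0<..<1}. h (x, \<gamma>) \<noteq> 0} = 0" if \<gamma>: "\<gamma> \<in> \<Gamma>" for \<gamma>
    proof -
      let ?f = "indicator ({0<..<1} \<times> {\<gamma>}) :: real \<times> 'g \<Rightarrow> real"
      note c = column[OF unc \<gamma>]
      have f: "?f \<in> Lp_fun (mu \<Gamma>) p"
        using c by (intro indicator_in_Lp_fun) (auto simp: sets_mu emeasure_mu)
      have "AE \<omega> in mu1 \<Gamma>. \<omega> \<notin> {0<..<1} \<times> {\<gamma>}"
        using c by (intro AE_not_in) (simp add: null_sets_def sets_mu1)
      then have "AE \<omega> in mu1 \<Gamma>. ?f \<omega> = 0" by eventually_elim simp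
      then have "AE \<omega> in mu \<Gamma>. h \<omega> * ?f \<omega> = 0"
        using band_projection_vanishing(2)[OF f]
        by (intro proj f Lp_fun_zero) (simp add: M assms(3))
      then obtain A where A: "A \<in> null_sets (mu \<Gamma>)" "{\<omega> \<in> Omega \<Gamma>. h \<omega> * ?f \<omega> \<noteq> 0} \<subseteq> A"
        by (auto simp: eventually_ae_filter space_mu)
      have sub: "{x \<in> {0<..<1}. h (x, \<gamma>) \<noteq> 0} \<subseteq> gslice A \<gamma>"
        using A(2) \<gamma> by (auto simp: Omega_def subset_iff)
      have "gslice A \<gamma> \<in> sets lborel"
        using A(1) \<gamma> by (auto simp: null_sets_def sets_mu slice_algebra_def)
      then show ?thesis
        using emeasure_mono[OF sub, of lborel] null_set_mu_slices(2)[OF unc A(1) \<gamma>] by simp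
    qed
    have "\<not> \<Gamma> \<subseteq> (\<Union>x\<in>{0<..<1}. {\<gamma>\<in>\<Gamma>. h (x, \<gamma>) \<noteq> 1})"
      using Union_countable_lepoll_real[OF row_h] not_le
      by (meson lepoll_trans subset_imp_lepoll)
    then obtain \<gamma> where \<gamma>: "\<gamma> \<in> \<Gamma>" "\<And>x. x \<in> {0<..<1} \<Longrightarrow> h (x, \<gamma>) = 1" by blast
    then have "{x \<in> {0<..<1}. h (x, \<gamma>) \<noteq> 0} = {0<..<1}" by auto
    then show False using column_h[OF \<gamma>(1)] by simp
  qed
  then have "\<not> (\<exists>h. locally_measurable (mu \<Gamma>) h \<and> (\<forall>F\<in>carrier E. \<forall>f\<in>F.
      band_projection E M F = Lp_class (mu \<Gamma>) p (\<lambda>\<omega>. h \<omega> * f \<omega>)))"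
    by meson
  moreover have "projection_band E M"
    using projection_band_vanishing by (simp only: M assms(3))
  ultimately show ?thesis by (rule conjI[rotated])
qed

end
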